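(* Let $H$, $L$, $D_s$, $D_a$ be the infinite matrices defined in the context, and for $k\ge 1$ let $L(k)$ be the $k\times k$ submatrix of $L$ with coefficients $l_{i,j}$, $0\le i,j<k$. Then: (i) $$H=D_s\,L\,D_a\,L^t\,D_s .$$ (ii) For every $n\ge 0$, $$L(2^{n+2})=\left(\begin{array}{cccc} A&0&0&0 \\ B&A&0&0 \\ 0&B&A&0 \\ B&A&B&A \end{array}\right),$$ where $A$ and $B$ are the $2^n\times 2^n$ submatrices of $L(2^{n+1})$ given by the block decomposition $L(2^{n+1})=\left(\begin{array}{cc} A&0 \\ B&A \end{array}\right)$.
   Context: All infinite matrices are indexed by integers $i,j\ge 0$ and have integer coefficients; $L^t$ denotes the transpose. The sequence $\mu=(\mu_0,\mu_1,\dots)=(1,1,0,1,0,0,0,1,\dots)$ is defined by $x\sum_{i=0}^\infty \mu_i x^i=\sum_{k=0}^\infty x^{2^k}$, and $H$ is its Hankel matrix, with coefficients $h_{i,j}=\mu_{i+j}$. The sequence $s_0,s_1,s_2,\dots\in\{\pm1\}$ is defined recursively by $s_0=1$, $s_{2i}=(-1)^i s_i$ and $s_{2i+1}=s_i$. $D_s$ is the infinite diagonal matrix with diagonal entries $s_0,s_1,s_2,\dots$, and $D_a$ is the infinite diagonal matrix with diagonal entries $1,-1,1,-1,\dots$ (i.e. $(-1)^i$ in position $i$). $L$ is the infinite unipotent lower triangular matrix with coefficients $l_{i,j}\in\{0,1\}$ given by $l_{i,j}\equiv\binom{2i+1}{i-j}\pmod 2$ (with the binomial coefficient equal to $0$ if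 $i<j$). *)

theory Defs
  imports
    "HOL-Library.Groups_Big_Fun"
    "HOL-Computational_Algebra.Formal_Power_Series"
    "Jordan_Normal_Form.Matrix"
begin

section \<open>Infinite integer matrices\<close>

type_synonym inf_mat = "nat \<Rightarrow> nat \<Rightarrow> int"

text \<open>
  The sum ranges over all \<^term>\<open>k :: nat\<close>. \<^const>\<open>Sum_any\<close> returns the junk value 0 when
  infinitely many summands are nonzero; by the finiteness lemmas below this never
  happens for row-finite left or column-finite right factors.
\<close>
definition inf_mult :: "inf_mat \<Rightarrow> inf_mat \<Rightarrow> inf_mat" (infixl "\<star>" 70) where
  "(M \<star> N) i j = Sum_any (\<lambda>k. M i k * N k j)"

definition inf_transpose :: "inf_mat \<Rightarrow> inf_mat" where
  "inf_transpose M i j = M j i"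

definition inf_diag :: "(nat \<Rightarrow> int) \<Rightarrow> inf_mat" where
  "inf_diag d i j = (if i = j then d i else 0)"

definition leading_mat :: "nat \<Rightarrow> inf_mat \<Rightarrow> int mat" where
  "leading_mat k M = mat k k (\<lambda>(i, j). M i j)"

definition row_finite :: "inf_mat \<Rightarrow> bool" where
  "row_finite M \<longleftrightarrow> (\<forall>i. finite {k. M i k \<noteq> 0})"

definition col_finite :: "inf_mat \<Rightarrow> bool" where
  "col_finite M \<longleftrightarrow> (\<forall>j. finite {k. M k j \<noteq> 0})"

lemma finite_inf_mult_summands:
  assumes "row_finite M \<or> col_finite N"
  shows "finite {k. M i k * N k j \<noteq> 0}"
proof -
  have "{k. M i k * N k j \<noteq> 0} \<subseteq> {k. M i k \<noteq> 0}" "{k. M i k * N k j \<noteq> 0} \<subseteq> {k. N k j \<noteq> 0}"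
    by auto
  with assms show ?thesis
    unfolding row_finite_def col_finite_def by (meson finite_subset)
qed

lemma row_finite_inf_mult:
  assumes "row_finite M" "row_finite N"
  shows "row_finite (M \<star> N)"
  unfolding row_finite_def
proof
  fix i
  have "{j. (M \<star> N) i j \<noteq> 0} \<subseteq> (\<Union>k\<in>{k. M i k \<noteq> 0}. {j. N k j \<noteq> 0})"
  proof
    fix j assume "j \<in> {j. (M \<star> N) i j \<noteq> 0}"
    then have "Sum_any (\<lambda>k. M i k * N k j) \<noteq> 0"
      by (simp add: inf_mult_def)
    then obtain k where "M i k * N k j \<noteq> 0"
      by (rule Sum_any.not_neutral_obtains_not_neutral)
    then show "j \<in> (\<Union>k\<in>{k. M i k \<noteq> 0}. {j. N k j \<noteq> 0})"
      by auto
  qed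
  moreover have "finite (\<Union>k\<in>{k. M i k \<noteq> 0}. {j. N k j \<noteq> 0})"
    using assms unfolding row_finite_def by blast
  ultimately show "finite {j. (M \<star> N) i j \<noteq> 0}"
    by (rule finite_subset)
qed

lemma row_finite_inf_diag: "row_finite (inf_diag d)"
  unfolding row_finite_def inf_diag_def by simp

lemma col_finite_inf_diag: "col_finite (inf_diag d)"
  unfolding col_finite_def inf_diag_def by simp

section \<open>The sequence \<open>\<mu>\<close> and its Hankel matrix\<close>

definition mu_gf :: "(nat \<Rightarrow> int) \<Rightarrow> bool" where
  "mu_gf m \<longleftrightarrow> (\<lambda>k. fps_X ^ (2 ^ k)) sums (fps_X * Abs_fps m)"

lemma mu_gf_iff: "mu_gf m \<longleftrightarrow> m = (\<lambda>i. if \<exists>k. i + 1 = 2 ^ k then 1 else 0)"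
proof -
  define c :: "nat \<Rightarrow> int" where "c = (\<lambda>i. if \<exists>k. i = 2 ^ k then 1 else 0)"
  have nth: "fps_nth (\<Sum>k<N. fps_X ^ (2 ^ k)) n = c n" if "n < N" for N n
  proof -
    have "fps_nth (\<Sum>k<N. fps_X ^ (2 ^ k)) n = (\<Sum>k<N. if n = 2 ^ k then 1 else (0::int))"
      by (simp add: fps_sum_nth fps_X_power_iff)
    also have "\<dots> = c n"
    proof (cases "\<exists>k. n = 2 ^ k")
      case True
      then obtain k where k: "n = 2 ^ k" by blast
      have "k < N"
        using that k less_exp[of k] by linarith
      have "(\<Sum>k'<N. if n = 2 ^ k' then 1 else (0::int)) = (\<Sum>k'<N. if k' = k then 1 else 0)"
        using k by (intro sum.cong) auto
      with \<open>k < N\<close> True show ?thesis by (simp add: c_def)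
    next
      case False
      then show ?thesis by (simp add: c_def)
    qed
    finally show ?thesis .
  qed
  have lim: "(\<lambda>k. fps_X ^ (2 ^ k)) sums Abs_fps c"
    unfolding sums_def
  proof (rule tendsto_fpsI)
    fix n
    show "\<forall>\<^sub>F N in sequentially.
        fps_nth (\<Sum>k<N. fps_X ^ (2 ^ k)) n = fps_nth (Abs_fps c) n"
      using eventually_gt_at_top[of n] by eventually_elim (simp add: nth)
  qed
  then have "mu_gf m \<longleftrightarrow> fps_X * Abs_fps m = Abs_fps c"
    unfolding mu_gf_def using sums_unique2 by metis
  also have "\<dots> \<longleftrightarrow> (\<forall>n. (if n = 0 then 0 else m (n - 1)) = c n)"
    by (simp add: fps_eq_iff)
  also have "\<dots> \<longleftrightarrow> (\<forall>n. m n = c (n + 1))"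
  proof -
    have "c 0 = 0" by (simp add: c_def)
    then show ?thesis
      by (metis One_nat_def add_diff_cancel_right' add_eq_0_iff_both_eq_0 nat.distinct(1)
          Suc_eq_plus1 not0_implies_Suc)
  qed
  finally show ?thesis
    by (auto simp: c_def fun_eq_iff)
qed

definition mu :: "nat \<Rightarrow> int" where
  "mu = (THE m. mu_gf m)"

lemma mu_gf_mu: "mu_gf mu"
  unfolding mu_def mu_gf_iff by simp

lemma mu_eq: "mu i = (if \<exists>k. i + 1 = 2 ^ k then 1 else 0)"
  using mu_gf_mu unfolding mu_gf_iff by (rule fun_cong)

definition H :: inf_mat where
  "H i j = mu (i + j)"

section \<open>The diagonal matrices\<close>

fun s :: "nat \<Rightarrow> int" where
  "s n = (if n = 0 then 1
          else if even n then (- 1) ^ (n div 2) * s (n div 2)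
          else s (n div 2))"

declare s.simps [simp del]

lemma s_recursion:
  "s 0 = 1"
  "s (2 * i) = (- 1) ^ i * s i"
  "s (2 * i + 1) = s i"
  by (subst s.simps; simp)+

definition D_s :: inf_mat where
  "D_s = inf_diag s"

definition D_a :: inf_mat where
  "D_a = inf_diag (\<lambda>i. (- 1) ^ i)"

section \<open>The unipotent matrix \<open>L\<close>\<close>

text \<open>The case distinction is needed because \<open>i - j\<close> is truncated subtraction.\<close>
definition L :: inf_mat where
  "L i j = (if i < j then 0 else int (((2 * i + 1) choose (i - j)) mod 2))"

lemma L_unipotent_lower_triangular:
  "L i i = 1" "i < j \<Longrightarrow> L i j = 0"
  by (simp_all add: L_def)

lemma row_finite_L: "row_finite L"
  unfolding row_finite_def
proof
  fix i
  have "{k. L i k \<noteq> 0} \<subseteq> {..i}"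
    by (auto simp: L_def not_less split: if_splits)
  then show "finite {k. L i k \<noteq> 0}"
    by (rule finite_subset) simp
qed

lemma row_finite_D_s_L_D_a: "row_finite (D_s \<star> L \<star> D_a)"
  unfolding D_s_def D_a_def
  by (intro row_finite_inf_mult row_finite_inf_diag row_finite_L)

end

theory Submission
  imports Defs
begin

text \<open>
  Modulo 2, Pascal's triangle satisfies Lucas' congruences, so doubling the two indices of \<open>L\<close>
  replaces every entry \<open>L a b\<close> by a \<open>2 \<times> 2\<close> tile. Its lower row is \<open>(L a b, L a b)\<close>; its upper
  row contains \<open>L a b\<close> once and \<open>0\<close> once, with \<open>L a b\<close> on the left if \<open>a + b\<close> is even and on the
  right if \<open>a + b\<close> is odd (\<open>L_odd_row\<close>, \<open>L_even_row\<close>). Both parts of the theorem are consequences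
  of this substitution rule.

  For the factorization, the \<open>(i, j)\<close> entry of \<open>L D\<^sub>a L\<^sup>t\<close> is the pairing
  \<open>S(i, j) = (\<Sum>k. (-1)\<^sup>k L i k L j k)\<close> of two rows of \<open>L\<close>. Grouping the columns \<open>2 b\<close> and
  \<open>2 b + 1\<close>, which carry opposite signs, and inserting the tiles gives
  \<open>S(2a+1, 2c+1) = 0\<close>, \<open>S(2a+1, 2c) = (-1)\<^sup>c S(a, c)\<close>, and \<open>S(2a, 2c) = (-1)\<^sup>a S(a, c)\<close> or \<open>0\<close>
  according to whether \<open>a + c\<close> is even or odd. The numbers \<open>s i s j \<mu>(i + j)\<close> obey the same
  recursion: the signs are those in the definition of \<open>s\<close>, and \<open>\<mu>(2n+1) = \<mu>(n)\<close> while
  \<open>\<mu>(2n) = 0\<close> for \<open>n > 0\<close>; the last fact also makes \<open>S(a, c)\<close> vanish when \<open>a + c\<close> is even and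
  positive, as required for \<open>S(2a, 2c)\<close>. Hence the two agree (\<open>L_signed_row_sum\<close>), and multiplying
  by \<open>D\<^sub>s\<close> on both sides cancels the signs because \<open>s\<close> takes the values \<open>1\<close> and \<open>-1\<close>.

  For the block structure, iterating the substitution \<open>n\<close> times shows that the \<open>2\<^sup>n \<times> 2\<^sup>n\<close> block of
  \<open>L\<close> at block position \<open>(p, q)\<close> is \<open>L p q\<close> times a matrix that depends only on the parity of
  \<open>p + q\<close>: it is \<open>A\<close> for even and \<open>B\<close> for odd \<open>p + q\<close> (\<open>L_self_similar\<close>). The pattern of blocks
  in \<open>L(2\<^sup>n\<^sup>+\<^sup>2)\<close> is therefore the pattern of entries in \<open>L(4)\<close>.
\<close>

section \<open>Binomial coefficients modulo 2\<close>

text \<open>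
  Applying Pascal's rule twice gives \<open>C(n+2, m) = C(n, m) + 2 C(n, m-1) + C(n, m-2)\<close>, so modulo 2
  the rows with even index satisfy Pascal's rule with step 2. This proves the next two lemmas.
\<close>

lemma even_binomial_double_odd: "even ((2 * n) choose (2 * k + 1))"
proof (induction n arbitrary: k)
  case (Suc n)
  from Suc[of k] Suc[of "k - 1"] show ?case
    by (cases k) simp_all
qed simp

lemma odd_binomial_double_even: "odd ((2 * n) choose (2 * k)) \<longleftrightarrow> odd (n choose k)"
proof (induction n arbitrary: k)
  case 0
  show ?case by (cases k) simp_all
next
  case (Suc n)
  from Suc[of k] Suc[of "k - 1"] show ?case
    by (cases k) (simp_all, blast)
qed

lemma odd_binomial_Suc_double:
  "odd (Suc (2 * n) choose (2 * k)) \<longleftrightarrow> odd (n choose k)"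
  "odd (Suc (2 * n) choose Suc (2 * k)) \<longleftrightarrow> odd (n choose k)"
proof -
  show "odd (Suc (2 * n) choose Suc (2 * k)) \<longleftrightarrow> odd (n choose k)"
    using even_binomial_double_odd[of n k] odd_binomial_double_even[of n k] by simp
  show "odd (Suc (2 * n) choose (2 * k)) \<longleftrightarrow> odd (n choose k)"
    using even_binomial_double_odd[of n "k - 1"] odd_binomial_double_even[of n k]
    by (cases k) simp_all
qed

section \<open>The substitution rule for \<open>L\<close>\<close>

lemma L_eq_of_bool: "L i j = of_bool (j \<le> i \<and> odd (Suc (2 * i) choose (i - j)))"
  by (auto simp: L_def even_iff_mod_2_eq_zero odd_iff_mod_2_eq_one simp del: binomial_Suc_Suc)

text \<open>
  With \<open>i = 2 a + 1\<close>, the relevant coefficients are \<open>C(2 (2 a + 1) + 1, m)\<close> with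
  \<open>m = 2 (a - b) + 1\<close> and \<open>m = 2 (a - b)\<close>; both reduce to \<open>C(2 a + 1, a - b)\<close>.
\<close>
lemma L_odd_row:
  "L (Suc (2 * a)) (2 * b) = L a b"
  "L (Suc (2 * a)) (Suc (2 * b)) = L a b"
proof -
  show "L (Suc (2 * a)) (2 * b) = L a b"
  proof (cases "b \<le> a")
    case True
    then have "Suc (2 * a) - 2 * b = Suc (2 * (a - b))" by simp
    with True odd_binomial_Suc_double(2)[of "Suc (2 * a)" "a - b"] show ?thesis
      by (simp add: L_eq_of_bool del: binomial_Suc_Suc)
  qed (simp add: L_def)
  show "L (Suc (2 * a)) (Suc (2 * b)) = L a b"
  proof (cases "b \<le> a")
    case True
    then have "Suc (2 * a) - (Suc (2 * b)) = 2 * (a - b)" by simp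
    with True odd_binomial_Suc_double(1)[of "Suc (2 * a)" "a - b"] show ?thesis
      by (simp add: L_eq_of_bool del: binomial_Suc_Suc)
  qed (simp add: L_def)
qed

text \<open>
  An even row of Pascal's triangle modulo 2 is the next row with its odd positions erased. This
  yields the parity condition in the substitution rule.
\<close>
lemma odd_binomial_even_upper:
  "odd ((2 * a) choose m) \<longleftrightarrow> even m \<and> odd (Suc (2 * a) choose m)"
proof (cases "even m")
  case True
  then obtain k where "m = 2 * k" by blast
  then show ?thesis
    by (simp add: odd_binomial_double_even odd_binomial_Suc_double del: binomial_Suc_Suc)
next
  case False
  then obtain k where "m = 2 * k + 1" by (rule oddE)
  then show ?thesis using even_binomial_double_odd[of a k] by simp
qed

text \<open>
  The coefficients belonging to the row \<open>2 a\<close> reduce to \<open>C(2 a, a - b)\<close> in the column \<open>2 b\<close> and to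
  \<open>C(2 a, a - b - 1)\<close> in the column \<open>2 b + 1\<close>. Their sum is \<open>C(2 a + 1, a - b)\<close>, which is \<open>L a b\<close>
  modulo 2, and the one whose lower index is odd vanishes.
\<close>
lemma L_even_row:
  "L (2 * a) (2 * b) = (if even (a + b) then L a b else 0)"
  "L (2 * a) (Suc (2 * b)) = (if even (a + b) then 0 else L a b)"
proof -
  show "L (2 * a) (2 * b) = (if even (a + b) then L a b else 0)"
  proof (cases "b \<le> a")
    case True
    then have "2 * a - 2 * b = 2 * (a - b)" by simp
    with True odd_binomial_Suc_double(1)[of "2 * a" "a - b"] odd_binomial_even_upper[of a "a - b"]
    show ?thesis
      by (simp add: L_eq_of_bool del: binomial_Suc_Suc)
  qed (simp add: L_def)
  show "L (2 * a) (Suc (2 * b)) = (if even (a + b) then 0 else L a b)"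
  proof (cases "b < a")
    case True
    define d where "d = a - Suc b"
    have a: "a = Suc (b + d)" using True by (simp add: d_def)
    have "2 * a - (Suc (2 * b)) = Suc (2 * d)" "a - b = Suc d" by (simp_all add: a)
    moreover have "odd (Suc (2 * (2 * a)) choose Suc (2 * d)) \<longleftrightarrow> odd ((2 * a) choose d)"
      by (rule odd_binomial_Suc_double)
    moreover have "odd (Suc (2 * a) choose Suc d) \<longleftrightarrow>
        (odd ((2 * a) choose d) \<longleftrightarrow> even ((2 * a) choose Suc d))"
      by (simp, blast)
    moreover have "even (a + b) \<longleftrightarrow> odd d" unfolding a by (simp, blast)
    ultimately show ?thesis
      using True odd_binomial_even_upper[of a "Suc d"] odd_binomial_even_upper[of a d]
      by (auto simp add: L_eq_of_bool simp del: binomial_Suc_Suc)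
  qed (cases "a = b"; simp add: L_def)
qed

section \<open>The factorization of the Hankel matrix\<close>

lemma sum_lessThan_double:
  fixes f :: "nat \<Rightarrow> 'a :: comm_monoid_add"
  shows "(\<Sum>k<2 * N. f k) = (\<Sum>b<N. f (2 * b) + f (Suc (2 * b)))"
  by (induction N) (simp_all add: add.assoc)

lemma mu_double:
  "mu (2 * n + 1) = mu n"
  "mu (2 * n) = (if n = 0 then 1 else 0)"
proof -
  have "(\<exists>k. 2 * n + 2 = (2::nat) ^ k) \<longleftrightarrow> (\<exists>k. n + 1 = 2 ^ k)"
  proof
    assume "\<exists>k. 2 * n + 2 = (2::nat) ^ k"
    then obtain k where k: "2 * n + 2 = (2::nat) ^ k" by blast
    then obtain l where "k = Suc l" by (cases k) auto
    with k have "n + 1 = 2 ^ l" by simp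
    then show "\<exists>k. n + 1 = 2 ^ k" by blast
  next
    assume "\<exists>k. n + 1 = 2 ^ k"
    then obtain k where "n + 1 = 2 ^ k" by blast
    then have "2 * n + 2 = (2::nat) ^ Suc k" by simp
    then show "\<exists>k. 2 * n + 2 = (2::nat) ^ k" by blast
  qed
  then show "mu (2 * n + 1) = mu n" by (simp add: mu_eq)
  have "(\<exists>k. 2 * n + 1 = (2::nat) ^ k) \<longleftrightarrow> n = 0"
  proof
    assume "\<exists>k. 2 * n + 1 = (2::nat) ^ k"
    then obtain k where k: "2 * n + 1 = (2::nat) ^ k" by blast
    have "k = 0"
    proof (rule ccontr)
      assume "k \<noteq> 0"
      then have "even ((2::nat) ^ k)" by simp
      then show False unfolding k[symmetric] by simp
    qed
    with k show "n = 0" by simp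
  qed (auto intro: exI[of _ 0])
  then show "mu (2 * n) = (if n = 0 then 1 else 0)" by (simp add: mu_eq)
qed

text \<open>
  The entries of \<open>L D\<^sub>a L\<^sup>t\<close>. Row \<open>i\<close> of \<open>L\<close> vanishes beyond column \<open>i\<close>, so the sum is the same for
  every bound \<open>N > i\<close>. Keeping \<open>N\<close> arbitrary lets one bound serve the rows \<open>i\<close> and \<open>i div 2\<close> alike
  in the induction.
\<close>
lemma L_signed_row_sum:
  assumes "i < N"
  shows "(\<Sum>k<N. (- 1) ^ k * L i k * L j k) = s i * s j * mu (i + j)"
  using assms
proof (induction "i + j" arbitrary: i j N rule: less_induct)
  case less
  define S where "S i j = (\<Sum>b<N. (- 1) ^ b * L i b * L j b)" for i j
  \<comment> \<open>The sum may be extended to \<open>k < 2 N\<close>; consecutive columns then combine with signs \<open>+\<close> and \<open>-\<close>.\<close>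
  have pairs: "S i j = (\<Sum>b<N. L i (2 * b) * L j (2 * b) - L i (Suc (2 * b)) * L j (Suc (2 * b)))"
  proof -
    have "S i j = (\<Sum>k<2 * N. (- 1) ^ k * L i k * L j k)"
      unfolding S_def using less.prems
      by (intro sum.mono_neutral_left) (auto simp: L_unipotent_lower_triangular)
    then show ?thesis by (simp add: sum_lessThan_double)
  qed
  have IH: "S a c = s a * s c * mu (a + c)" if "a + c < i + j" "a \<le> i" for a c
    unfolding S_def using less.hyps[of a c N] that less.prems by simp
  have "i = 2 * (i div 2) \<or> i = Suc (2 * (i div 2))" "j = 2 * (j div 2) \<or> j = Suc (2 * (j div 2))"
    by presburger+
  then obtain a c where "i = 2 * a \<or> i = Suc (2 * a)" "j = 2 * c \<or> j = Suc (2 * c)"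
    by blast
  then consider "i = Suc (2 * a)" "j = Suc (2 * c)" | "i = Suc (2 * a)" "j = 2 * c"
    | "i = 2 * a" "j = Suc (2 * c)" | "i = 2 * a" "j = 2 * c" by blast
  then have "S i j = s i * s j * mu (i + j)"
  proof cases
    case 1
    then have "i + j = 2 * (a + c + 1)" by simp
    then have "mu (i + j) = 0" by (simp only: mu_double) simp
    with 1 pairs show ?thesis by (simp add: L_odd_row)
  next
    case 2
    have "S i j = (- 1) ^ c * S a c"
      unfolding pairs unfolding S_def sum_distrib_left
      by (intro sum.cong) (auto simp: 2 L_odd_row L_even_row minus_one_power_iff)
    also have "S a c = s a * s c * mu (a + c)"
      using 2 by (intro IH) auto
    also have "mu (a + c) = mu (i + j)"
      using mu_double(1)[of "a + c"] by (simp add: 2 algebra_simps)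
    finally show ?thesis
      unfolding 2 s_recursion(2) s_recursion(3)[simplified] by (simp add: mult_ac)
  next
    case 3
    have "S i j = (- 1) ^ a * S a c"
      unfolding pairs unfolding S_def sum_distrib_left
      by (intro sum.cong) (auto simp: 3 L_odd_row L_even_row minus_one_power_iff)
    also have "S a c = s a * s c * mu (a + c)"
      using 3 by (intro IH) auto
    also have "mu (a + c) = mu (i + j)"
      using mu_double(1)[of "a + c"] by (simp add: 3 algebra_simps)
    finally show ?thesis
      unfolding 3 s_recursion(2) s_recursion(3)[simplified] by (simp add: mult_ac)
  next
    case 4
    have S_rec: "S i j = (if even (a + c) then (- 1) ^ a * S a c else 0)"
      unfolding pairs unfolding S_def sum_distrib_left
      by (auto simp: 4 L_even_row minus_one_power_iff intro!: sum.cong sum.neutral)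
    \<comment> \<open>For \<open>i = j = 0\<close> the recursion refers back to itself, so this entry is computed directly.\<close>
    show ?thesis
    proof (cases "a + c = 0")
      case True
      have "{..<N} = insert 0 {1..<N}" using less.prems by auto
      then have "S 0 0 = 1" unfolding S_def by (simp add: L_unipotent_lower_triangular)
      with True 4 show ?thesis by (simp add: s_recursion mu_double(2)[of 0, simplified])
    next
      case False
      have "mu (i + j) = 0"
        using False mu_double(2)[of "a + c"] by (simp add: 4 algebra_simps)
      moreover have "S i j = 0"
      proof (cases "even (a + c)")
        case True
        \<comment> \<open>The factor \<open>\<mu>(a + c)\<close> vanishes because \<open>a + c\<close> is even and positive.\<close>
        then obtain d where d: "a + c = 2 * d" by blast
        have "S a c = s a * s c * mu (a + c)"
          using False 4 by (intro IH) auto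
        with False d show ?thesis by (simp add: S_rec mu_double)
      qed (simp add: S_rec)
      ultimately show ?thesis by simp
    qed
  qed
  then show ?case by (simp add: S_def)
qed

lemma inf_mult_diag_left: "(inf_diag d \<star> M) i j = d i * M i j"
proof -
  have "inf_diag d i k * M k j = (if k = i then d i * M i j else 0)" for k
    by (simp add: inf_diag_def)
  then show ?thesis by (simp add: inf_mult_def)
qed

lemma inf_mult_diag_right: "(M \<star> inf_diag d) i j = M i j * d j"
proof -
  have "M i k * inf_diag d k j = (if k = j then M i j * d j else 0)" for k
    by (simp add: inf_diag_def)
  then show ?thesis by (simp add: inf_mult_def)
qed

lemma square_s: "s n * s n = 1"
  by (induction n rule: s.induct) (subst (1 2) s.simps, auto simp: minus_one_power_iff)

lemma H_factorization: "H = D_s \<star> L \<star> D_a \<star> inf_transpose L \<star> D_s"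
proof (intro ext)
  fix i j
  have "(D_s \<star> L \<star> D_a \<star> inf_transpose L \<star> D_s) i j =
      Sum_any (\<lambda>k. s i * L i k * (- 1) ^ k * L j k) * s j"
    unfolding D_s_def D_a_def inf_mult_diag_right
    by (subst inf_mult_def)
      (simp add: inf_mult_diag_left inf_mult_diag_right inf_transpose_def)
  also have "Sum_any (\<lambda>k. s i * L i k * (- 1) ^ k * L j k) =
      (\<Sum>k<Suc i. s i * L i k * (- 1) ^ k * L j k)"
    by (intro Sum_any.expand_superset)
      (auto simp: L_def split: if_splits)
  also have "\<dots> = s i * (\<Sum>k<Suc i. (- 1) ^ k * L i k * L j k)"
    unfolding sum_distrib_left by (intro sum.cong) (simp_all add: mult_ac)
  also have "\<dots> = s i * (s i * s j * mu (i + j))"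
    by (subst L_signed_row_sum) simp_all
  also have "\<dots> * s j = (s i * s i) * (s j * s j) * mu (i + j)"
    by (simp only: mult_ac)
  also have "\<dots> = H i j" by (simp add: square_s H_def)
  finally show "H i j = (D_s \<star> L \<star> D_a \<star> inf_transpose L \<star> D_s) i j" ..
qed

section \<open>Self-similarity and the block structure\<close>

lemma L_small:
  "L 0 0 = 1" "L 0 (Suc 0) = 0" "L (Suc 0) 0 = 1" "L (Suc 0) (Suc 0) = 1"
  "L (Suc (Suc 0)) 0 = 0" "L (Suc (Suc 0)) (Suc 0) = 1"
  "L (Suc (Suc (Suc 0))) 0 = 1" "L (Suc (Suc (Suc 0))) (Suc 0) = 1"
  using L_odd_row[of 0 0] L_even_row[of 1 0] L_odd_row[of 1 0]
  by (simp_all add: L_unipotent_lower_triangular numeral_eq_Suc)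

text \<open>
  In the induction step the block of size \<open>2\<^sup>n\<^sup>+\<^sup>1\<close> at position \<open>(p, q)\<close> is cut into four blocks of size
  \<open>2\<^sup>n\<close> at positions \<open>(2 p + e, 2 q + f)\<close>. The parity of \<open>(2 p + e) + (2 q + f)\<close> is that of
  \<open>e + f\<close>, independently of \<open>p\<close> and \<open>q\<close>, so the same small block \<open>T\<close> occurs at \<open>(e, f)\<close>, at
  \<open>(2 + e, f)\<close> and at \<open>(2 p + e, 2 q + f)\<close>, and only its scalar factors have to be compared. That
  comparison is the substitution rule.
\<close>
lemma L_self_similar:
  assumes "i < 2 ^ n" "j < 2 ^ n"
  shows "L (p * 2 ^ n + i) (q * 2 ^ n + j) =
    L p q * (if even (p + q) then L i j else L (2 ^ n + i) j)"
  using assms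
proof (induction n arbitrary: p q i j)
  case 0
  then show ?case by (simp add: L_def)
next
  case (Suc n)
  \<comment> \<open>The digits \<open>e\<close> and \<open>f\<close> tell in which half of the block the indices \<open>i\<close> and \<open>j\<close> lie.\<close>
  have split: "\<exists>e i'. i = e * 2 ^ n + i' \<and> i' < 2 ^ n \<and> (e = 0 \<or> e = 1)"
    if "i < 2 ^ Suc n" for i :: nat
  proof (cases "i < 2 ^ n")
    case False
    with that show ?thesis by (intro exI[of _ 1] exI[of _ "i - 2 ^ n"]) simp
  qed (intro exI[of _ 0] exI[of _ i], simp)
  obtain e i' where i: "i = e * 2 ^ n + i'" "i' < 2 ^ n" "e = 0 \<or> e = 1"
    using split Suc.prems by blast
  obtain f j' where j: "j = f * 2 ^ n + j'" "j' < 2 ^ n" "f = 0 \<or> f = 1"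
    using split Suc.prems by blast
  define T where "T = (if even (e + f) then L i' j' else L (2 ^ n + i') j')"
  have T: "L (p * 2 ^ n + i') (q * 2 ^ n + j') = L p q * T" if "even (p + q) \<longleftrightarrow> even (e + f)" for p q
    using Suc.IH[OF i(2) j(2), of p q] that by (simp add: T_def)
  have "L (p * 2 ^ Suc n + i) (q * 2 ^ Suc n + j) = L (2 * p + e) (2 * q + f) * T"
    using T[of "2 * p + e" "2 * q + f"] by (simp add: i j algebra_simps)
  also have "L (2 * p + e) (2 * q + f) =
      L p q * (if even (p + q) then L e f else L (2 + e) f)"
    using i(3) j(3) L_odd_row[of p q] L_even_row[of p q] L_small by auto
  also have "\<dots> * T = L p q * (if even (p + q) then L i j else L (2 ^ Suc n + i) j)"
  proof -
    have "L i j = L e f * T"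
      using T[of e f] by (simp add: i j)
    moreover have "L (2 ^ Suc n + i) j = L (2 + e) f * T"
      using T[of "2 + e" f] by (simp add: i j add_mult_distrib mult_2 add.assoc)
    ultimately show ?thesis by simp
  qed
  finally show ?case .
qed

definition L_block :: "nat \<Rightarrow> nat \<Rightarrow> nat \<Rightarrow> int mat" where
  "L_block n p q = mat (2 ^ n) (2 ^ n) (\<lambda>(i, j). L (p * 2 ^ n + i) (q * 2 ^ n + j))"

lemma leading_mat_L_eq_L_block: "leading_mat (2 ^ n) L = L_block n 0 0"
  by (simp add: leading_mat_def L_block_def)

lemma L_block_Suc:
  "L_block (Suc n) p q =
    four_block_mat (L_block n (2 * p) (2 * q)) (L_block n (2 * p) (2 * q + 1))
      (L_block n (2 * p + 1) (2 * q)) (L_block n (2 * p + 1) (2 * q + 1))"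
  by (intro eq_matI) (auto simp: L_block_def algebra_simps)

lemma L_block_eq:
  "L_block n p q = L p q \<cdot>\<^sub>m (if even (p + q) then L_block n 0 0 else L_block n 1 0)"
  by (intro eq_matI) (auto simp: L_block_def L_self_similar)

lemma L_block_cases:
  "L p q = 0 \<Longrightarrow> L_block n p q = 0\<^sub>m (2 ^ n) (2 ^ n)"
  "L p q = 1 \<Longrightarrow> even (p + q) \<Longrightarrow> L_block n p q = L_block n 0 0"
  "L p q = 1 \<Longrightarrow> odd (p + q) \<Longrightarrow> L_block n p q = L_block n 1 0"
  by (subst L_block_eq, intro eq_matI; simp add: L_block_def)+

theorem theorem1p2:
  "H = D_s \<star> L \<star> D_a \<star> inf_transpose L \<star> D_s \<and>
   (\<forall>n. \<exists>A B.
      split_block (leading_mat (2 ^ (n + 1)) L) (2 ^ n) (2 ^ n)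
        = (A, 0\<^sub>m (2 ^ n) (2 ^ n), B, A) \<and>
      leading_mat (2 ^ (n + 2)) L =
        (let Z = 0\<^sub>m (2 ^ n) (2 ^ n) in
          four_block_mat
            (four_block_mat A Z
                            B A) (four_block_mat Z Z
                                                 Z Z)
            (four_block_mat Z B
                            B A) (four_block_mat A Z
                                                 B A)))"
proof (intro conjI allI exI)
  show "H = D_s \<star> L \<star> D_a \<star> inf_transpose L \<star> D_s"
    by (rule H_factorization)
next
  fix n
  let ?A = "L_block n 0 0" and ?B = "L_block n 1 0" and ?Z = "0\<^sub>m (2 ^ n) (2 ^ n) :: int mat"
  have "leading_mat (2 ^ (n + 1)) L = four_block_mat ?A ?Z ?B ?A"
    using L_block_cases(1)[of 0 1 n] L_block_cases(2)[of 1 1 n]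
    by (simp add: leading_mat_L_eq_L_block L_block_Suc L_unipotent_lower_triangular del: power_Suc)
  then show "split_block (leading_mat (2 ^ (n + 1)) L) (2 ^ n) (2 ^ n) = (?A, ?Z, ?B, ?A)"
    by (auto simp: split_block_def Let_def L_block_def intro!: eq_matI)
next
  fix n
  let ?A = "L_block n 0 0" and ?B = "L_block n 1 0" and ?Z = "0\<^sub>m (2 ^ n) (2 ^ n) :: int mat"
  have "L 0 1 = 0" "L 0 2 = 0" "L 0 3 = 0" "L 1 2 = 0" "L 1 3 = 0" "L 2 3 = 0" "L 2 0 = 0"
    using L_small by (simp_all add: L_unipotent_lower_triangular numeral_eq_Suc)
  then have zero: "L_block n 0 1 = ?Z" "L_block n 0 2 = ?Z" "L_block n 0 3 = ?Z"
      "L_block n 1 2 = ?Z" "L_block n 1 3 = ?Z" "L_block n 2 3 = ?Z" "L_block n 2 0 = ?Z"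
    by (simp_all only: L_block_cases(1))
  have "L 1 1 = 1" "L 2 2 = 1" "L 3 3 = 1" "L 3 1 = 1"
    using L_small by (simp_all add: L_unipotent_lower_triangular numeral_eq_Suc)
  then have diag: "L_block n 1 1 = ?A" "L_block n 2 2 = ?A" "L_block n 3 3 = ?A" "L_block n 3 1 = ?A"
    using L_block_cases(2)[of 1 1] L_block_cases(2)[of 2 2]
      L_block_cases(2)[of 3 3] L_block_cases(2)[of 3 1] by simp_all
  have "L 2 1 = 1" "L 3 0 = 1" "L 3 2 = 1"
    using L_small L_odd_row(1)[of 1 1]
    by (simp_all add: L_unipotent_lower_triangular numeral_eq_Suc)
  then have off: "L_block n 2 1 = ?B" "L_block n 3 0 = ?B" "L_block n 3 2 = ?B"
    using L_block_cases(3)[of 2 1] L_block_cases(3)[of 3 0] L_block_cases(3)[of 3 2]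
    by simp_all
  have "leading_mat (2 ^ (n + 2)) L = L_block (Suc (Suc n)) 0 0"
    by (simp add: leading_mat_L_eq_L_block flip: power_Suc)
  also have "\<dots> = four_block_mat
      (four_block_mat ?A ?Z ?B ?A) (four_block_mat ?Z ?Z ?Z ?Z)
      (four_block_mat ?Z ?B ?B ?A) (four_block_mat ?A ?Z ?B ?A)"
    using zero diag off by (simp add: L_block_Suc)
  finally show "leading_mat (2 ^ (n + 2)) L = (let Z = ?Z in
      four_block_mat (four_block_mat ?A Z ?B ?A) (four_block_mat Z Z Z Z)
        (four_block_mat Z ?B ?B ?A) (four_block_mat ?A Z ?B ?A))"
    by (simp add: Let_def)
qed

end
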